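(* Let $B = B(F)$ be a stationary generalized Bratteli diagram with symmetric incidence matrix $F$, and suppose that $A=F^T$ is realized as a self-adjoint (possibly unbounded) operator acting in $\ell^2(V_0)$. Assume that $A$ has an orthonormal basis $\{\xi^{(k)}\}$ of eigenvectors of $\ell^2(V_0)$ with finite eigenvalues $\lambda_k$, i.e. $A\xi^{(k)}=\lambda_k\xi^{(k)}$. Define $M_n := \inf_{v\in V_n} H_v^{(n)}$. If for every fixed $k$, $$\frac{\lambda_k^n}{M_n} \to 0\quad\text{as } n\to \infty,$$ then $B$ admits no tail invariant probability measure on its path space $X_B$.
   Context: A generalized Bratteli diagram $B=(V,E)$ is a graded graph with vertex set $V=\bigsqcup_{n\ge 0}V_n$ and edge set $E=\bigsqcup_{n\ge 0}E_n$, where every $V_n$ is countably infinite, each edge $e\in E_n$ has a source $s(e)\in V_n$ and a range $r(e)\in V_{n+1}$ (multiple edges are allowed), $s^{-1}(v)\neq\emptyset$ for every $v\in V$, and $r^{-1}(v)$ is nonempty and finite for every $v\in V\setminus V_0$. The incidence matrices are $F_n=(f^{(n)}_{v,w})_{v\in V_{n+1},\,w\in V_n}$, where $f^{(n)}_{v,w}\in\{0,1,2,\dots\}$ is the number of edges from $w\in V_n$ to $v\in V_{n+1}$. The diagram is stationary, written $B=B(F)$, if all $V_n$ are identified with $V_0$ and $F_n=F$ for all $n$. The path space $X_B$ is the set of infinite edge sequences $(x_0,x_1,\dots)$ with $x_i\in E_i$ and $r(x_i)=s(x_{i+1})$ for all $i$ (so paths start in $V_0$). For a finite path $\overline e=(e_0,\dots,e_n)$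 starting in $V_0$, set $r(\overline e)=r(e_n)$, and let $[\overline e]=\{x\in X_B: x_i=e_i,\ 0\le i\le n\}$ be the associated cylinder set; cylinder sets form a base of clopen sets of the (Polish, zero-dimensional) topology of $X_B$. Two paths $x,y\in X_B$ are tail equivalent if $x_i=y_i$ for all sufficiently large $i$. Standing assumptions: $X_B$ has no isolated points, and the tail equivalence relation is aperiodic (all classes are infinite). A Borel measure $\mu$ on $X_B$ is tail invariant if $\mu([\overline e])=\mu([\overline e'])$ whenever $\overline e,\overline e'$ are finite paths starting at level $0$ with $r(\overline e)=r(\overline e')$. For $v\in V_n$, $H^{(n)}_v=\sum_{w\in V_0}(F^n)_{v,w}$ is the total (finite) number of finite paths from $V_0$ to $v$. "$A$ is realized as a self-adjoint operator in $\ell^2(V_0)$" means: there is a self-adjoint operator, again denoted $A$, with dense domain $D(A)\subset\ell^2(V_0)$, acting by the matrix: $(Ax)_i=\sum_{j}a_{ij}x_j$ for $x\in D(A)$, where $A=(a_{ij})$ is the matrix $F^T$. *)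

theory Defs
  imports "HOL-Probability.Probability"
begin

section \<open>Generalized Bratteli diagrams\<close>

text \<open>
  The disjoint unions over all levels are encoded by level-indexed families: a vertex of the
  diagram is a pair of a level \<open>n\<close> and an element of \<open>vertices B n\<close>, and likewise for edges.
  Hence the sets at different levels need not be disjoint as sets of labels, and the
  identification of all levels in a stationary diagram is literal equality of the label sets.
\<close>

record ('v, 'e) bratteli =
  vertices :: "nat \<Rightarrow> 'v set"
  edges :: "nat \<Rightarrow> 'e set"
  src :: "nat \<Rightarrow> 'e \<Rightarrow> 'v"
  rng :: "nat \<Rightarrow> 'e \<Rightarrow> 'v"

definition generalized_bratteli :: "('v, 'e) bratteli \<Rightarrow> bool" where
  "generalized_bratteli B \<longleftrightarrow>
     (\<forall>n. countable (vertices B n) \<and> infinite (vertices B n)) \<and>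
     (\<forall>n. \<forall>e\<in>edges B n. src B n e \<in> vertices B n \<and> rng B n e \<in> vertices B (Suc n)) \<and>
     (\<forall>n. \<forall>v\<in>vertices B n. {e \<in> edges B n. src B n e = v} \<noteq> {}) \<and>
     (\<forall>n. \<forall>v\<in>vertices B (Suc n).
        {e \<in> edges B n. rng B n e = v} \<noteq> {} \<and> finite {e \<in> edges B n. rng B n e = v})"

text \<open>Row index \<open>v\<close> at level \<open>n + 1\<close>, column index \<open>w\<close> at level \<open>n\<close>.\<close>

definition incidence :: "('v, 'e) bratteli \<Rightarrow> nat \<Rightarrow> 'v \<Rightarrow> 'v \<Rightarrow> nat" where
  "incidence B n v w = card {e \<in> edges B n. rng B n e = v \<and> src B n e = w}"

definition stationary :: "('v, 'e) bratteli \<Rightarrow> ('v \<Rightarrow> 'v \<Rightarrow> nat) \<Rightarrow> bool" where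
  "stationary B F \<longleftrightarrow>
     (\<forall>n. vertices B n = vertices B 0) \<and>
     (\<forall>n. \<forall>v\<in>vertices B 0. \<forall>w\<in>vertices B 0. incidence B n v w = F v w)"


section \<open>The path space\<close>

definition path_space :: "('v, 'e) bratteli \<Rightarrow> (nat \<Rightarrow> 'e) set" where
  "path_space B =
     {x. \<forall>i. x i \<in> edges B i \<and> rng B i (x i) = src B (Suc i) (x (Suc i))}"

definition finite_paths :: "('v, 'e) bratteli \<Rightarrow> 'e list set" where
  "finite_paths B =
     {es. es \<noteq> [] \<and> (\<forall>i<length es. es ! i \<in> edges B i) \<and>
          (\<forall>i. Suc i < length es \<longrightarrow> rng B i (es ! i) = src B (Suc i) (es ! Suc i))}"

text \<open>The level is part of the range vertex, so paths with the same range have the same length.\<close>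

definition path_range :: "('v, 'e) bratteli \<Rightarrow> 'e list \<Rightarrow> nat \<times> 'v" where
  "path_range B es = (length es, rng B (length es - 1) (last es))"

definition cylinder :: "('v, 'e) bratteli \<Rightarrow> 'e list \<Rightarrow> (nat \<Rightarrow> 'e) set" where
  "cylinder B es = {x \<in> path_space B. \<forall>i<length es. x i = es ! i}"

text \<open>
  The library operation takes a subbase; two cylinder sets are nested or disjoint, so the cylinder
  sets are a base of the topology they generate.
\<close>

definition path_topology :: "('v, 'e) bratteli \<Rightarrow> (nat \<Rightarrow> 'e) topology" where
  "path_topology B = topology_generated_by (cylinder B ` finite_paths B)"

lemma topspace_path_topology: "topspace (path_topology B) = path_space B"
proof -
  have "x \<in> (\<Union>es\<in>finite_paths B. cylinder B es)" if "x \<in> path_space B" for x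
    using that by (intro UN_I[of "[x 0]"]) (auto simp: path_space_def finite_paths_def cylinder_def)
  moreover have "cylinder B es \<subseteq> path_space B" for es
    by (auto simp: cylinder_def)
  ultimately show ?thesis
    unfolding path_topology_def topology_generated_by_topspace by blast
qed

definition path_borel :: "('v, 'e) bratteli \<Rightarrow> (nat \<Rightarrow> 'e) measure" where
  "path_borel B = sigma (path_space B) {U. openin (path_topology B) U}"

lemma sets_path_borel:
  "sets (path_borel B) = sigma_sets (path_space B) {U. openin (path_topology B) U}"
  unfolding path_borel_def
  by (rule sets_measure_of) (use openin_subset topspace_path_topology in fastforce)

definition tail_equivalent :: "(nat \<Rightarrow> 'e) \<Rightarrow> (nat \<Rightarrow> 'e) \<Rightarrow> bool" where
  "tail_equivalent x y \<longleftrightarrow> (\<forall>\<^sub>F i in sequentially. x i = y i)"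

definition no_isolated_points :: "('v, 'e) bratteli \<Rightarrow> bool" where
  "no_isolated_points B \<longleftrightarrow> (\<forall>x\<in>path_space B. \<not> openin (path_topology B) {x})"

definition aperiodic :: "('v, 'e) bratteli \<Rightarrow> bool" where
  "aperiodic B \<longleftrightarrow> (\<forall>x\<in>path_space B. infinite {y \<in> path_space B. tail_equivalent x y})"

definition tail_invariant :: "('v, 'e) bratteli \<Rightarrow> (nat \<Rightarrow> 'e) measure \<Rightarrow> bool" where
  "tail_invariant B M \<longleftrightarrow>
     (\<forall>es\<in>finite_paths B. \<forall>es'\<in>finite_paths B.
        path_range B es = path_range B es' \<longrightarrow>
        emeasure M (cylinder B es) = emeasure M (cylinder B es'))"


section \<open>Matrix powers and path counts\<close>

text \<open>
  Matrices are indexed by an infinite set \<open>V\<close>, over which \<open>sum\<close> would be \<open>0\<close> by convention;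
  \<open>infsum\<close> is used instead. For incidence matrices of generalized Bratteli diagrams every row has
  finite support, so that all these sums have only finitely many nonzero terms.
\<close>

primrec matrix_power :: "'v set \<Rightarrow> ('v \<Rightarrow> 'v \<Rightarrow> nat) \<Rightarrow> nat \<Rightarrow> 'v \<Rightarrow> 'v \<Rightarrow> nat" where
  "matrix_power V F 0 v w = (if v = w then 1 else 0)"
| "matrix_power V F (Suc n) v w = (\<Sum>\<^sub>\<infinity>u\<in>V. F v u * matrix_power V F n u w)"

definition path_count :: "'v set \<Rightarrow> ('v \<Rightarrow> 'v \<Rightarrow> nat) \<Rightarrow> nat \<Rightarrow> 'v \<Rightarrow> nat" where
  "path_count V F n v = (\<Sum>\<^sub>\<infinity>w\<in>V. matrix_power V F n v w)"

definition inf_path_count :: "('v, 'e) bratteli \<Rightarrow> ('v \<Rightarrow> 'v \<Rightarrow> nat) \<Rightarrow> nat \<Rightarrow> real" where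
  "inf_path_count B F n = (INF v\<in>vertices B n. real (path_count (vertices B 0) F n v))"


section \<open>Unbounded operators on square-summable functions\<close>

text \<open>
  The complex Hilbert space of square-summable functions on \<open>V\<close>. Functions are required to vanish
  outside \<open>V\<close>, so that equality in the space is equality of HOL functions.
\<close>

definition ell2 :: "'v set \<Rightarrow> ('v \<Rightarrow> complex) set" where
  "ell2 V = {x. (\<forall>v. v \<notin> V \<longrightarrow> x v = 0) \<and> (\<lambda>v. (cmod (x v))\<^sup>2) summable_on V}"

definition ell2_inner :: "'v set \<Rightarrow> ('v \<Rightarrow> complex) \<Rightarrow> ('v \<Rightarrow> complex) \<Rightarrow> complex" where
  "ell2_inner V x y = (\<Sum>\<^sub>\<infinity>v\<in>V. x v * cnj (y v))"

definition ell2_norm :: "'v set \<Rightarrow> ('v \<Rightarrow> complex) \<Rightarrow> real" where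
  "ell2_norm V x = sqrt (\<Sum>\<^sub>\<infinity>v\<in>V. (cmod (x v))\<^sup>2)"

definition ell2_dense :: "'v set \<Rightarrow> ('v \<Rightarrow> complex) set \<Rightarrow> bool" where
  "ell2_dense V S \<longleftrightarrow>
     S \<subseteq> ell2 V \<and> (\<forall>x\<in>ell2 V. \<forall>\<epsilon>>0. \<exists>y\<in>S. ell2_norm V (\<lambda>v. x v - y v) < \<epsilon>)"

definition orthonormal_basis :: "'v set \<Rightarrow> (nat \<Rightarrow> 'v \<Rightarrow> complex) \<Rightarrow> bool" where
  "orthonormal_basis V \<xi> \<longleftrightarrow>
     (\<forall>k. \<xi> k \<in> ell2 V) \<and>
     (\<forall>k l. ell2_inner V (\<xi> k) (\<xi> l) = (if k = l then 1 else 0)) \<and>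
     ell2_dense V {\<lambda>v. \<Sum>k\<in>K. c k * \<xi> k v | K c. finite K}"

definition linear_operator ::
  "'v set \<Rightarrow> ('v \<Rightarrow> complex) set \<Rightarrow> (('v \<Rightarrow> complex) \<Rightarrow> 'v \<Rightarrow> complex) \<Rightarrow> bool" where
  "linear_operator V D T \<longleftrightarrow>
     D \<subseteq> ell2 V \<and> T ` D \<subseteq> ell2 V \<and> (\<lambda>v. 0) \<in> D \<and>
     (\<forall>x\<in>D. \<forall>y\<in>D. (\<lambda>v. x v + y v) \<in> D \<and> T (\<lambda>v. x v + y v) = (\<lambda>v. T x v + T y v)) \<and>
     (\<forall>c. \<forall>x\<in>D. (\<lambda>v. c * x v) \<in> D \<and> T (\<lambda>v. c * x v) = (\<lambda>v. c * T x v))"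

text \<open>
  The graph of the Hilbert space adjoint of the operator \<open>T\<close> with domain \<open>D\<close>; it is the graph of a
  function when \<open>D\<close> is dense.
\<close>

definition adjoint_graph ::
  "'v set \<Rightarrow> ('v \<Rightarrow> complex) set \<Rightarrow> (('v \<Rightarrow> complex) \<Rightarrow> 'v \<Rightarrow> complex) \<Rightarrow>
     (('v \<Rightarrow> complex) \<times> ('v \<Rightarrow> complex)) set" where
  "adjoint_graph V D T =
     {(y, z). y \<in> ell2 V \<and> z \<in> ell2 V \<and> (\<forall>x\<in>D. ell2_inner V (T x) y = ell2_inner V x z)}"

definition self_adjoint_operator ::
  "'v set \<Rightarrow> ('v \<Rightarrow> complex) set \<Rightarrow> (('v \<Rightarrow> complex) \<Rightarrow> 'v \<Rightarrow> complex) \<Rightarrow> bool" where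
  "self_adjoint_operator V D T \<longleftrightarrow>
     linear_operator V D T \<and> ell2_dense V D \<and> (\<lambda>x. (x, T x)) ` D = adjoint_graph V D T"

definition acts_by_matrix ::
  "'v set \<Rightarrow> ('v \<Rightarrow> 'v \<Rightarrow> complex) \<Rightarrow> ('v \<Rightarrow> complex) set \<Rightarrow>
     (('v \<Rightarrow> complex) \<Rightarrow> 'v \<Rightarrow> complex) \<Rightarrow> bool" where
  "acts_by_matrix V a D T \<longleftrightarrow> (\<forall>x\<in>D. \<forall>i\<in>V. ((\<lambda>j. a i j * x j) has_sum T x i) V)"

end

theory Submission
  imports Defs
begin

text \<open>
  Suppose \<open>\<mu>\<close> is a tail invariant probability measure, and let \<open>q n v\<close> be the common measure of the
  cylinder sets of the paths from level \<open>0\<close> to the vertex \<open>v\<close> at level \<open>n\<close>. Splitting a cylinder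
  set according to its next edge shows that \<open>q n w = (\<Sum>v. F v w * q (Suc n) v)\<close>, that is,
  \<open>q n = A (q (Suc n))\<close> as a formal matrix product, and \<open>q 0\<close> sums to \<open>1\<close>
  (\<open>tail_invariant_weights\<close>).

  Two families of functions are paired with these weights. Let \<open>H n v\<close> be the number of paths
  from level \<open>0\<close> to \<open>v\<close> at level \<open>n\<close>, and \<open>M n\<close> its infimum over \<open>v\<close>. The path counts satisfy
  \<open>H (Suc n) = F (H n)\<close>, so exchanging the order of summation of nonnegative terms gives
  \<open>(\<Sum>v. q n v * H n v) = (\<Sum>v. q 0 v * H 0 v) = 1\<close>, whence \<open>M n * (\<Sum>v. q n v) \<le> 1\<close>. An
  eigenvector satisfies \<open>F \<xi> = \<lambda> \<xi>\<close> by symmetry of \<open>F\<close>, so the same exchange gives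
  \<open>(\<Sum>v. q 0 v * \<xi> v) = \<lambda> ^ n * (\<Sum>v. q n v * \<xi> v)\<close>. It is legitimate because \<open>\<xi>\<close> is bounded and
  \<open>q n\<close> is summable, so that the double series converges absolutely
  (\<open>has_sum_transpose_pairing\<close>).
  As a unit vector has entries of modulus at most \<open>1\<close>, the modulus of the left-hand side is at most
  \<open>\<bar>\<lambda>\<bar> ^ n / M n\<close>, which tends to \<open>0\<close>. Hence \<open>q 0\<close>, which is summable and bounded and therefore
  square-summable, is orthogonal to every vector of an orthonormal basis. So \<open>q 0\<close> vanishes
  (\<open>orthogonal_to_basis_imp_0\<close>), while its entries sum to \<open>1\<close>.
\<close>

section \<open>Moving a matrix across a weighted sum\<close>

text \<open>
  This is the identity \<open>\<langle>K\<^sup>T p', h\<rangle> = \<langle>p', K h\<rangle>\<close> with \<open>p = K\<^sup>T p'\<close> and \<open>g = K h\<close>. Because \<open>K\<close> and \<open>p'\<close>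
  are nonnegative, summing the moduli of the terms over \<open>v\<close> first yields \<open>p w * norm (h w)\<close>, so that
  summability of this single function already makes the double series absolutely convergent.
\<close>

lemma has_sum_transpose_pairing:
  fixes K :: "'a \<Rightarrow> 'a \<Rightarrow> nat" and p p' :: "'a \<Rightarrow> real" and h g :: "'a \<Rightarrow> 'b :: {banach, real_normed_field}"
  assumes nonneg: "\<And>v. v \<in> V \<Longrightarrow> 0 \<le> p' v"
    and p: "\<And>w. w \<in> V \<Longrightarrow> ((\<lambda>v. real (K v w) * p' v) has_sum p w) V"
    and g: "\<And>v. v \<in> V \<Longrightarrow> ((\<lambda>w. of_nat (K v w) * h w) has_sum g v) V"
    and summable: "(\<lambda>w. p w * norm (h w)) summable_on V"
    and S: "((\<lambda>w. of_real (p w) * h w) has_sum S) V"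
  shows "((\<lambda>v. of_real (p' v) * g v) has_sum S) V"
proof -
  define f where "f = (\<lambda>(w, v). of_real (real (K v w) * p' v) * h w)"
  have "(\<lambda>z. norm (f z)) summable_on V \<times> V"
  proof (rule summable_on_SigmaI[OF _ summable])
    fix w assume w: "w \<in> V"
    have "((\<lambda>v. real (K v w) * p' v * norm (h w)) has_sum p w * norm (h w)) V"
      by (intro has_sum_cmult_left p w)
    then show "((\<lambda>v. norm (f (w, v))) has_sum p w * norm (h w)) V"
      by (rule has_sum_cong[THEN iffD1, rotated]) (simp add: f_def norm_mult nonneg)
  qed auto
  then have "f summable_on V \<times> V"
    by (rule abs_summable_summable)
  moreover have "((\<lambda>v. f (w, v)) has_sum of_real (p w) * h w) V" if "w \<in> V" for w
    unfolding f_def prod.case by (intro has_sum_cmult_left has_sum_of_real p that)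
  ultimately have "(f has_sum S) (V \<times> V)"
    using S by (intro has_sum_SigmaI)
  then have "((\<lambda>(v, w). f (w, v)) has_sum S) (V \<times> V)"
    by (subst (asm) has_sum_swap)
  then show ?thesis
  proof (rule has_sum_SigmaD)
    fix v assume v: "v \<in> V"
    have "((\<lambda>w. of_real (p' v) * (of_nat (K v w) * h w)) has_sum of_real (p' v) * g v) V"
      by (intro has_sum_cmult_right g v)
    then show "((\<lambda>w. case (v, w) of (v, w) \<Rightarrow> f (w, v)) has_sum of_real (p' v) * g v) V"
      by (simp add: f_def mult_ac)
  qed
qed


section \<open>Path counts\<close>

lemma finite_support_matrix_power:
  assumes "\<And>v. v \<in> V \<Longrightarrow> finite {u \<in> V. F v u \<noteq> 0}" and "v \<in> V"
  shows "finite {w \<in> V. matrix_power V F n v w \<noteq> 0}"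
  using assms(2)
proof (induction n arbitrary: v)
  case 0
  have "{w \<in> V. matrix_power V F 0 v w \<noteq> 0} \<subseteq> {v}" by auto
  then show ?case by (rule finite_subset) simp
next
  case (Suc n)
  have "{w \<in> V. matrix_power V F (Suc n) v w \<noteq> 0}
      \<subseteq> (\<Union>u\<in>{u \<in> V. F v u \<noteq> 0}. {w \<in> V. matrix_power V F n u w \<noteq> 0})"
  proof
    fix w assume w: "w \<in> {w \<in> V. matrix_power V F (Suc n) v w \<noteq> 0}"
    have "\<exists>u\<in>V. F v u * matrix_power V F n u w \<noteq> 0"
    proof (rule ccontr)
      assume "\<not> ?thesis"
      then have "matrix_power V F (Suc n) v w = 0"
        unfolding matrix_power.simps by (intro infsum_0) auto
      with w show False by simp
    qed
    with w show "w \<in> (\<Union>u\<in>{u \<in> V. F v u \<noteq> 0}. {w \<in> V. matrix_power V F n u w \<noteq> 0})"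
      by auto
  qed
  moreover have "finite (\<Union>u\<in>{u \<in> V. F v u \<noteq> 0}. {w \<in> V. matrix_power V F n u w \<noteq> 0})"
    using assms(1)[OF Suc.prems] Suc.IH by auto
  ultimately show ?case by (rule finite_subset)
qed

lemma path_count_0: "v \<in> V \<Longrightarrow> path_count V F 0 v = 1"
  unfolding path_count_def
  by (intro infsumI has_sum_finite_neutralI[of "{v}"]) auto

text \<open>
  Powers of \<open>F\<close> are built by multiplication on the left, so row sums obey the recursion
  \<open>H (Suc n) = F (H n)\<close>; finite rows turn all the series involved into finite sums.
\<close>

lemma path_count_Suc:
  assumes fin: "\<And>v. v \<in> V \<Longrightarrow> finite {u \<in> V. F v u \<noteq> 0}" and v: "v \<in> V"
  shows "((\<lambda>u. F v u * path_count V F n u) has_sum path_count V F (Suc n) v) V"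
proof -
  define U where "U = {u \<in> V. F v u \<noteq> 0}"
  \<comment> \<open>A finite set carrying all entries that contribute to the two path counts.\<close>
  define W where "W = (\<Union>u\<in>U. {w \<in> V. matrix_power V F n u w \<noteq> 0})"
  have U: "finite U" "U \<subseteq> V"
    using fin[OF v] by (auto simp: U_def)
  have W: "finite W" "W \<subseteq> V"
    using U finite_support_matrix_power[of V F, OF fin] by (auto simp: W_def)
  have step: "matrix_power V F (Suc n) v w = (\<Sum>u\<in>U. F v u * matrix_power V F n u w)" for w
    unfolding matrix_power.simps
    by (intro infsumI has_sum_finite_neutralI[OF U]) (auto simp: U_def)
  have count: "path_count V F n u = (\<Sum>w\<in>W. matrix_power V F n u w)" if "u \<in> U" for u
    unfolding path_count_def
    by (intro infsumI has_sum_finite_neutralI[OF W]) (use that in \<open>auto simp: W_def\<close>)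
  have "path_count V F (Suc n) v = (\<Sum>w\<in>W. matrix_power V F (Suc n) v w)"
    unfolding path_count_def
    by (intro infsumI has_sum_finite_neutralI[OF W]) (auto simp: W_def step simp del: matrix_power.simps)
  also have "\<dots> = (\<Sum>u\<in>U. \<Sum>w\<in>W. F v u * matrix_power V F n u w)"
    unfolding step by (rule sum.swap)
  also have "\<dots> = (\<Sum>u\<in>U. F v u * path_count V F n u)"
    by (simp add: count sum_distrib_left)
  finally show ?thesis
    by (intro has_sum_finite_neutralI[OF U]) (auto simp: U_def)
qed

lemma path_count_pos:
  assumes fin: "\<And>v. v \<in> V \<Longrightarrow> finite {u \<in> V. F v u \<noteq> 0}"
    and nz: "\<And>v. v \<in> V \<Longrightarrow> \<exists>u\<in>V. F v u \<noteq> 0" and v: "v \<in> V"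
  shows "0 < path_count V F n v"
  using v
proof (induction n arbitrary: v)
  case 0
  then show ?case by (simp add: path_count_0)
next
  case (Suc n)
  obtain u where u: "u \<in> V" "F v u \<noteq> 0" using nz[OF Suc.prems] by blast
  have "(\<Sum>u\<in>{u}. F v u * path_count V F n u) \<le> path_count V F (Suc n) v"
    by (rule has_sum_mono_neutral[OF has_sum_finite path_count_Suc[of V F v n]])
      (use u fin Suc.prems in auto)
  then show ?case using u Suc.IH[OF u(1)] by (auto intro: less_le_trans[rotated])
qed

lemma stationary_rows:
  assumes B: "generalized_bratteli B" and st: "stationary B F" and v: "v \<in> vertices B 0"
  shows "finite {u \<in> vertices B 0. F v u \<noteq> 0}" and "\<exists>u\<in>vertices B 0. F v u \<noteq> 0"
proof -
  define R where "R = {e \<in> edges B 0. rng B 0 e = v}"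
  have "v \<in> vertices B (Suc 0)"
    using st v by (auto simp: stationary_def)
  then have R: "finite R" "R \<noteq> {}"
    using B unfolding generalized_bratteli_def R_def by blast+
  have F: "F v u = card {e \<in> R. src B 0 e = u}" if "u \<in> vertices B 0" for u
    using st v that unfolding stationary_def incidence_def R_def by simp
  have "{u \<in> vertices B 0. F v u \<noteq> 0} \<subseteq> src B 0 ` R"
  proof
    fix u assume u: "u \<in> {u \<in> vertices B 0. F v u \<noteq> 0}"
    then have "card {e \<in> R. src B 0 e = u} \<noteq> 0"
      using F[of u] by simp
    then have "{e \<in> R. src B 0 e = u} \<noteq> {}"
      using card.empty by fastforce
    then show "u \<in> src B 0 ` R" by auto
  qed
  then show "finite {u \<in> vertices B 0. F v u \<noteq> 0}"
    by (rule finite_subset) (simp add: R)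
  obtain e where e: "e \<in> R" using R by blast
  then have s: "src B 0 e \<in> vertices B 0"
    using B by (auto simp: generalized_bratteli_def R_def)
  have "F v (src B 0 e) \<noteq> 0"
    unfolding F[OF s] using R e by auto
  with s show "\<exists>u\<in>vertices B 0. F v u \<noteq> 0" by blast
qed


section \<open>The weights of a tail invariant measure\<close>

text \<open>
  Countable additivity over an arbitrary countable index set, obtained from the version for sequences
  by enumerating \<open>I\<close> and padding with empty sets.
\<close>

lemma (in finite_measure) has_sum_measure_UN:
  assumes I: "countable I" and X: "\<And>i. i \<in> I \<Longrightarrow> X i \<in> sets M" and disj: "disjoint_family_on X I"
  shows "((\<lambda>i. measure M (X i)) has_sum measure M (\<Union>i\<in>I. X i)) I"
proof -
  define Y where "Y n = (if n \<in> to_nat_on I ` I then X (from_nat_into I n) else {})" for n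
  have Y: "Y (to_nat_on I i) = X i" if "i \<in> I" for i
    using that I by (simp add: Y_def)
  have Un: "(\<Union>n. Y n) = (\<Union>i\<in>I. X i)"
  proof
    show "(\<Union>n. Y n) \<subseteq> (\<Union>i\<in>I. X i)"
      using I by (auto simp: Y_def split: if_splits)
    show "(\<Union>i\<in>I. X i) \<subseteq> (\<Union>n. Y n)"
      using Y by blast
  qed
  have "range Y \<subseteq> sets M"
    using X I by (auto simp: Y_def)
  moreover have "disjoint_family Y"
    using disj I by (auto simp: disjoint_family_on_def Y_def) blast
  ultimately have "(\<lambda>n. measure M (Y n)) sums measure M (\<Union>n. Y n)"
    by (rule finite_measure_UNION)
  then have "((\<lambda>n. measure M (Y n)) has_sum measure M (\<Union>n. Y n)) UNIV"
    by (rule sums_nonneg_imp_has_sum) simp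
  then have "((\<lambda>n. measure M (Y n)) has_sum measure M (\<Union>i\<in>I. X i)) (to_nat_on I ` I)"
    unfolding Un by (rule has_sum_cong_neutral[THEN iffD1, rotated -1]) (auto simp: Y_def)
  then have "((\<lambda>i. measure M (Y (to_nat_on I i))) has_sum measure M (\<Union>i\<in>I. X i)) I"
    using I by (subst (asm) has_sum_reindex) (auto simp: o_def)
  then show ?thesis
    by (rule has_sum_cong[THEN iffD1, rotated]) (simp add: Y)
qed

lemma countable_edges:
  assumes "generalized_bratteli B"
  shows "countable (edges B n)"
proof -
  have "edges B n \<subseteq> (\<Union>v\<in>vertices B (Suc n). {e \<in> edges B n. rng B n e = v})"
    using assms by (auto simp: generalized_bratteli_def)
  moreover have "countable (\<Union>v\<in>vertices B (Suc n). {e \<in> edges B n. rng B n e = v})"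
    using assms unfolding generalized_bratteli_def
    by (intro countable_UN) (auto intro: countable_finite)
  ultimately show ?thesis by (rule countable_subset)
qed

lemma cylinder_in_sets:
  assumes "sets M = sets (path_borel B)" and "es \<in> finite_paths B"
  shows "cylinder B es \<in> sets M"
  unfolding assms(1) sets_path_borel path_topology_def
  using assms(2) by (intro sigma_sets.Basic CollectI topology_generated_by_Basis imageI)

text \<open>
  Every vertex of level \<open>0\<close> receives the empty path, so that one statement about the extension of
  paths by an edge covers level \<open>0\<close> as well, where \<open>finite_paths\<close> offers no path to extend.
\<close>

definition paths_into :: "('v, 'e) bratteli \<Rightarrow> nat \<Rightarrow> 'v \<Rightarrow> 'e list set" where
  "paths_into B n v = (if n = 0 then {[]} else {es \<in> finite_paths B. path_range B es = (n, v)})"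

text \<open>
  The condition on the source makes these sets meaningful at level \<open>0\<close>, where they consist of the
  paths that start at \<open>v\<close>. At higher levels they are the cylinder sets.
\<close>

definition cell :: "('v, 'e) bratteli \<Rightarrow> nat \<Rightarrow> 'v \<Rightarrow> 'e list \<Rightarrow> (nat \<Rightarrow> 'e) set" where
  "cell B n v es = {x \<in> path_space B. (\<forall>i<n. x i = es ! i) \<and> src B n (x n) = v}"

lemma last_eq_nth: "length es = Suc n \<Longrightarrow> last es = es ! n"
  by (cases es rule: rev_cases) auto

lemma length_paths_into: "es \<in> paths_into B n v \<Longrightarrow> length es = n"
  by (auto simp: paths_into_def path_range_def split: if_splits)

lemma cell_eq_cylinder:
  assumes "es \<in> paths_into B (Suc n) v"
  shows "cell B (Suc n) v es = cylinder B es"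
proof -
  have es: "length es = Suc n" "rng B n (es ! n) = v"
    using assms by (auto simp: paths_into_def path_range_def last_eq_nth)
  have "src B (Suc n) (x (Suc n)) = v" if "x \<in> cylinder B es" for x
  proof -
    have "src B (Suc n) (x (Suc n)) = rng B n (x n)"
      using that by (simp add: cylinder_def path_space_def)
    moreover have "x n = es ! n"
      using that es by (simp add: cylinder_def)
    ultimately show ?thesis using es by simp
  qed
  then show ?thesis
    using es by (auto simp: cell_def cylinder_def)
qed

lemma snoc_paths_into:
  assumes "es \<in> paths_into B n (src B n e)" and "e \<in> edges B n"
  shows "es @ [e] \<in> paths_into B (Suc n) (rng B n e)"
proof -
  have len: "length es = n" using assms(1) by (rule length_paths_into)
  have es: "es ! i \<in> edges B i" if "i < n" for i
    using assms(1) that by (auto simp: paths_into_def finite_paths_def path_range_def split: if_splits)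
  have conn: "rng B i (es ! i) = src B (Suc i) (es ! Suc i)" if "Suc i < n" for i
    using assms(1) that by (auto simp: paths_into_def finite_paths_def path_range_def split: if_splits)
  have last: "rng B i (es ! i) = src B n e" if "Suc i = n" for i
    using assms(1) that len
    by (auto simp: paths_into_def path_range_def last_eq_nth split: if_splits)
  have "es @ [e] \<in> finite_paths B"
    unfolding finite_paths_def
    using es conn last len assms(2)
    by (auto simp: nth_append less_Suc_eq)
  then show ?thesis
    by (simp add: paths_into_def path_range_def len)
qed

lemma paths_into_nonempty:
  assumes "generalized_bratteli B" and "v \<in> vertices B n"
  shows "paths_into B n v \<noteq> {}"
  using assms(2)
proof (induction n arbitrary: v)
  case 0
  then show ?case by (simp add: paths_into_def)
next
  case (Suc n)
  then obtain e where e: "e \<in> edges B n" "rng B n e = v"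
    using assms(1) unfolding generalized_bratteli_def by blast
  then have "src B n e \<in> vertices B n"
    using assms(1) by (auto simp: generalized_bratteli_def)
  then obtain es where "es \<in> paths_into B n (src B n e)"
    using Suc.IH by blast
  from snoc_paths_into[OF this e(1)] show ?case
    using e(2) by auto
qed

lemma cell_eq_UN_cylinder:
  assumes "es \<in> paths_into B n w"
  shows "cell B n w es = (\<Union>e\<in>{e \<in> edges B n. src B n e = w}. cylinder B (es @ [e]))"
  using length_paths_into[OF assms]
  by (auto simp: cell_def cylinder_def path_space_def nth_append less_Suc_eq)

lemma disjoint_cylinder_snoc:
  fixes B :: "('v, 'e) bratteli"
  shows "disjoint_family_on (\<lambda>e. cylinder B (es @ [e])) I"
proof (unfold disjoint_family_on_def, intro ballI impI)
  fix d e :: 'e assume "d \<noteq> e"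
  moreover have "x (length es) = e" if "x \<in> cylinder B (es @ [e])" for x e
    using that by (auto simp: cylinder_def dest: spec[of _ "length es"])
  ultimately show "cylinder B (es @ [d]) \<inter> cylinder B (es @ [e]) = {}"
    by blast
qed

text \<open>
  Tail invariance is used to see that the weight \<open>q n v\<close> does not depend on the path into \<open>v\<close>; the
  recursion groups the one-edge extensions of such a path by their range.
\<close>

lemma tail_invariant_weights:
  fixes B :: "('v, 'e) bratteli"
  assumes B: "generalized_bratteli B" and st: "stationary B F"
    and M: "sets \<mu> = sets (path_borel B)" "prob_space \<mu>" and inv: "tail_invariant B \<mu>"
  obtains q :: "nat \<Rightarrow> 'v \<Rightarrow> real"
  where "\<And>n v. 0 \<le> q n v"
    and "(q 0 has_sum 1) (vertices B 0)"
    and "\<And>n w. w \<in> vertices B 0 \<Longrightarrow>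
           ((\<lambda>v. real (F v w) * q (Suc n) v) has_sum q n w) (vertices B 0)"
proof
  interpret prob_space \<mu> by fact
  let ?V = "vertices B 0"
  have V: "vertices B n = ?V" for n
    using st by (auto simp: stationary_def)
  define q where "q n v = measure \<mu> (cell B n v (SOME es. es \<in> paths_into B n v))" for n v
  show "0 \<le> q n v" for n v by (simp add: q_def)
  have q: "measure \<mu> (cell B n v es) = q n v" if es: "es \<in> paths_into B n v" for n v es
  proof -
    define es' where "es' = (SOME es. es \<in> paths_into B n v)"
    have es': "es' \<in> paths_into B n v"
      unfolding es'_def using es by (rule someI)
    have q_es': "q n v = measure \<mu> (cell B n v es')"
      by (simp add: q_def es'_def)
    show ?thesis
    proof (cases n)
      case 0
      then show ?thesis
        using es es' q_es' by (simp add: paths_into_def)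
    next
      case (Suc m)
      have "emeasure \<mu> (cylinder B es) = emeasure \<mu> (cylinder B es')"
        using inv es es' by (simp add: tail_invariant_def paths_into_def Suc)
      then show ?thesis
        using es es' q_es' by (simp add: cell_eq_cylinder measure_def Suc)
    qed
  qed
  have q_Suc: "measure \<mu> (cylinder B es) = q (Suc n) v" if "es \<in> paths_into B (Suc n) v" for n v es
    using q[OF that] by (simp add: cell_eq_cylinder[OF that])
  have cyl: "cylinder B es \<in> sets \<mu>" if "es \<in> paths_into B (Suc n) v" for n v es
    using that M by (intro cylinder_in_sets) (auto simp: paths_into_def)

  show "((\<lambda>v. real (F v w) * q (Suc n) v) has_sum q n w) ?V" if w: "w \<in> ?V" for n w
  proof -
    define E where "E = {e \<in> edges B n. src B n e = w}"
    have E: "countable E"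
      unfolding E_def using countable_edges[OF B] by (rule countable_subset[rotated]) auto
    obtain es where es: "es \<in> paths_into B n w"
      using paths_into_nonempty[OF B, of w n] w V by auto
    have ext: "es @ [e] \<in> paths_into B (Suc n) (rng B n e)" if "e \<in> E" for e
      using snoc_paths_into[of es B n e] es that by (simp add: E_def)
    have "((\<lambda>e. measure \<mu> (cylinder B (es @ [e]))) has_sum
        measure \<mu> (\<Union>e\<in>E. cylinder B (es @ [e]))) E"
      by (rule has_sum_measure_UN[OF E cyl[OF ext] disjoint_cylinder_snoc])
    also have "(\<Union>e\<in>E. cylinder B (es @ [e])) = cell B n w es"
      unfolding E_def by (rule cell_eq_UN_cylinder[OF es, symmetric])
    finally have "((\<lambda>e. q (Suc n) (rng B n e)) has_sum q n w) E"
      unfolding q[OF es] by (rule has_sum_cong[THEN iffD1, rotated]) (use q_Suc ext in blast)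
    moreover have "rng B n e \<in> ?V" if "e \<in> E" for e
      using B V[of "Suc n"] that by (auto simp: generalized_bratteli_def E_def)
    then have "bij_betw snd (Sigma ?V (\<lambda>v. {e \<in> E. rng B n e = v})) E"
      by (intro bij_betwI[where g = "\<lambda>e. (rng B n e, e)"]) auto
    ultimately have "((\<lambda>z. q (Suc n) (rng B n (snd z))) has_sum q n w)
        (Sigma ?V (\<lambda>v. {e \<in> E. rng B n e = v}))"
      by (subst has_sum_reindex_bij_betw)
    then show ?thesis
    proof (rule has_sum_SigmaD)
      fix v assume v: "v \<in> ?V"
      have "finite {e \<in> edges B n. rng B n e = v}"
        using B V[of "Suc n"] v by (auto simp: generalized_bratteli_def)
      then have "finite {e \<in> E. rng B n e = v}"
        by (rule finite_subset[rotated]) (auto simp: E_def)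
      moreover have "card {e \<in> E. rng B n e = v} = F v w"
        using st v w by (auto simp: stationary_def incidence_def E_def conj_ac
            intro!: arg_cong[where f = card])
      ultimately show "((\<lambda>e. q (Suc n) (rng B n (snd (v, e)))) has_sum real (F v w) * q (Suc n) v)
          {e \<in> E. rng B n e = v}"
        by (intro has_sum_finiteI) auto
    qed
  qed

  have cell0: "[] \<in> paths_into B 0 v" for v by (simp add: paths_into_def)
  have "((\<lambda>v. measure \<mu> (cell B 0 v [])) has_sum measure \<mu> (\<Union>v\<in>?V. cell B 0 v [])) ?V"
  proof (rule has_sum_measure_UN)
    show "countable ?V" using B by (simp add: generalized_bratteli_def)
    show "disjoint_family_on (\<lambda>v. cell B 0 v []) ?V"
      by (auto simp: disjoint_family_on_def cell_def)
    fix v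
    have "countable {e \<in> edges B 0. src B 0 e = v}"
      using countable_edges[OF B] by (rule countable_subset[rotated]) auto
    moreover have "cylinder B ([] @ [e]) \<in> sets \<mu>" if "e \<in> edges B 0" for e
      using that by (intro cyl[OF snoc_paths_into[OF cell0]])
    ultimately show "cell B 0 v [] \<in> sets \<mu>"
      unfolding cell_eq_UN_cylinder[OF cell0] by (intro sets.countable_UN') auto
  qed
  also have "(\<Union>v\<in>?V. cell B 0 v []) = path_space B"
    using B by (auto simp: cell_def path_space_def generalized_bratteli_def)
  also have "path_space B = space \<mu>"
    using sets_eq_imp_space_eq[OF M(1)] by (simp add: path_borel_def space_measure_of_conv)
  finally show "(q 0 has_sum 1) ?V"
    unfolding q[OF cell0] prob_space by simp
qed


section \<open>Square-summable functions\<close>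

lemma ell2_unit_vector_le_1:
  assumes x: "x \<in> ell2 V" and unit: "ell2_inner V x x = 1" and v: "v \<in> V"
  shows "cmod (x v) \<le> 1"
proof -
  have sm: "(\<lambda>v. (cmod (x v))\<^sup>2) summable_on V"
    using x by (simp add: ell2_def)
  have "ell2_inner V x x = (\<Sum>\<^sub>\<infinity>v\<in>V. complex_of_real ((cmod (x v))\<^sup>2))"
    unfolding ell2_inner_def complex_norm_square ..
  also have "\<dots> = complex_of_real (\<Sum>\<^sub>\<infinity>v\<in>V. (cmod (x v))\<^sup>2)"
    using sm by (intro infsumI has_sum_of_real has_sum_infsum)
  finally have "(\<Sum>\<^sub>\<infinity>v\<in>V. (cmod (x v))\<^sup>2) = 1"
    using unit by (metis of_real_eq_1_iff)
  then have "((\<lambda>v. (cmod (x v))\<^sup>2) has_sum 1) V"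
    using sm by (metis has_sum_infsum)
  from finite_sum_le_has_sum[OF this, of "{v}"] have "(cmod (x v))\<^sup>2 \<le> 1"
    using v by simp
  then show ?thesis by (simp add: power_le_one_iff)
qed

text \<open>
  If \<open>q\<close> is orthogonal to every \<open>\<xi> k\<close>, then it is orthogonal to every \<open>y\<close> in their span, and
  Pythagoras gives \<open>\<parallel>q - y\<parallel>\<^sup>2 = \<parallel>q\<parallel>\<^sup>2 + \<parallel>y\<parallel>\<^sup>2 \<ge> \<parallel>q\<parallel>\<^sup>2\<close>. So the span approximates \<open>q\<close> only if
  \<open>q\<close> is zero.
\<close>

lemma orthogonal_to_basis_imp_0:
  fixes q :: "'v \<Rightarrow> real"
  assumes basis: "orthonormal_basis V \<xi>"
    and q2: "(\<lambda>v. (q v)\<^sup>2) summable_on V"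
    and orth: "\<And>k. ((\<lambda>v. of_real (q v) * \<xi> k v) has_sum 0) V"
    and v: "v \<in> V"
  shows "q v = 0"
proof (rule ccontr)
  assume "q v \<noteq> 0"
  define N where "N = (\<Sum>\<^sub>\<infinity>v\<in>V. (q v)\<^sup>2)"
  have N: "((\<lambda>v. (q v)\<^sup>2) has_sum N) V"
    unfolding N_def using q2 by (rule has_sum_infsum)
  have "0 < N"
    using finite_sum_le_has_sum[OF N, of "{v}"] v \<open>q v \<noteq> 0\<close>
    by (auto intro: less_le_trans[rotated])
  define x where "x v = (if v \<in> V then complex_of_real (q v) else 0)" for v
  have "(\<lambda>v. (cmod (x v))\<^sup>2) summable_on V"
    using q2 by (rule summable_on_cong[THEN iffD1, rotated]) (simp add: x_def)
  then have "x \<in> ell2 V"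
    by (simp add: ell2_def x_def)
  moreover have dense: "ell2_dense V {\<lambda>v. \<Sum>k\<in>K. c k * \<xi> k v | K c. finite K}"
    using basis by (simp add: orthonormal_basis_def)
  moreover have "0 < sqrt N"
    using \<open>0 < N\<close> by simp
  ultimately obtain y where y: "y \<in> {\<lambda>v. \<Sum>k\<in>K. c k * \<xi> k v | K c. finite K}"
      and close: "ell2_norm V (\<lambda>v. x v - y v) < sqrt N"
    unfolding ell2_dense_def by blast
  have "y \<in> ell2 V"
    using y dense unfolding ell2_dense_def by blast
  then obtain Y where Y: "((\<lambda>v. (cmod (y v))\<^sup>2) has_sum Y) V"
    by (auto simp: ell2_def summable_on_def)
  have "0 \<le> Y" using Y by (rule has_sum_nonneg) simp
  obtain K c where K: "finite K" "y = (\<lambda>v. \<Sum>k\<in>K. c k * \<xi> k v)" using y by blast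
  have "((\<lambda>v. of_real (q v) * y v) has_sum 0) V"
  proof -
    have vanish: "((\<lambda>v. c k * (of_real (q v) * \<xi> k v)) has_sum 0) V" for k
      using has_sum_cmult_right[OF orth, of "c k" k] by simp
    have "((\<lambda>v. \<Sum>k\<in>K. c k * (of_real (q v) * \<xi> k v)) has_sum 0) V"
      using \<open>finite K\<close>
      by (induction K rule: finite_induct) (auto dest: has_sum_add[OF vanish])
    then show ?thesis
      by (simp add: K sum_distrib_left mult_ac)
  qed
  from has_sum_Re[OF this] have "((\<lambda>v. q v * Re (y v)) has_sum 0) V" by simp
  from has_sum_add[OF has_sum_add[OF N Y] has_sum_cmult_right[OF this, of "- 2"]]
  have "((\<lambda>v. (q v)\<^sup>2 + (cmod (y v))\<^sup>2 + (- 2) * (q v * Re (y v))) has_sum N + Y) V"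
    by simp
  moreover have "(cmod (x v - y v))\<^sup>2 = (q v)\<^sup>2 + (cmod (y v))\<^sup>2 + (- 2) * (q v * Re (y v))"
    if "v \<in> V" for v
    using that by (simp add: x_def cmod_power2 power2_diff)
  ultimately have "((\<lambda>v. (cmod (x v - y v))\<^sup>2) has_sum N + Y) V"
    by (simp cong: has_sum_cong)
  then have "ell2_norm V (\<lambda>v. x v - y v) = sqrt (N + Y)"
    by (simp add: ell2_norm_def infsumI)
  with close \<open>0 \<le> Y\<close> show False by simp
qed


section \<open>Absence of tail invariant probability measures\<close>

theorem theorem1p2:
  fixes B :: "('v, 'e) bratteli"
    and F :: "'v \<Rightarrow> 'v \<Rightarrow> nat"
    and D :: "('v \<Rightarrow> complex) set"
    and A :: "('v \<Rightarrow> complex) \<Rightarrow> 'v \<Rightarrow> complex"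
    and \<xi> :: "nat \<Rightarrow> 'v \<Rightarrow> complex"
    and ev :: "nat \<Rightarrow> complex"
  assumes "generalized_bratteli B"
    and "no_isolated_points B"
    and "aperiodic B"
    and "stationary B F"
    and "\<forall>v\<in>vertices B 0. \<forall>w\<in>vertices B 0. F v w = F w v"
    and "self_adjoint_operator (vertices B 0) D A"
    and "acts_by_matrix (vertices B 0) (\<lambda>i j. of_nat (F j i)) D A"
    and "orthonormal_basis (vertices B 0) \<xi>"
    and "\<forall>k. \<xi> k \<in> D \<and> A (\<xi> k) = (\<lambda>v. ev k * \<xi> k v)"
    and "\<forall>k. (\<lambda>n. ev k ^ n / of_real (inf_path_count B F n)) \<longlonglongrightarrow> 0"
  shows "\<not> (\<exists>\<mu>. sets \<mu> = sets (path_borel B) \<and> prob_space \<mu> \<and> tail_invariant B \<mu>)"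
proof
  assume "\<exists>\<mu>. sets \<mu> = sets (path_borel B) \<and> prob_space \<mu> \<and> tail_invariant B \<mu>"
  then obtain \<mu> where "sets \<mu> = sets (path_borel B)" "prob_space \<mu>" "tail_invariant B \<mu>"
    by blast
  from tail_invariant_weights[OF assms(1,4) this] obtain q :: "nat \<Rightarrow> 'v \<Rightarrow> real"
    where q_nonneg: "\<And>n v. 0 \<le> q n v"
    and q_0: "(q 0 has_sum 1) (vertices B 0)"
    and q_Suc: "\<And>n w. w \<in> vertices B 0 \<Longrightarrow>
           ((\<lambda>v. real (F v w) * q (Suc n) v) has_sum q n w) (vertices B 0)"
    by blast
  define V where "V = vertices B 0"
  define H where "H n v = real (path_count V F n v)" for n v
  define m where "m n = inf_path_count B F n" for n
  note q_0 = q_0[folded V_def] and q_Suc = q_Suc[folded V_def]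
  note rows = stationary_rows[OF assms(1,4), folded V_def]

  \<comment> \<open>This keeps \<open>m n\<close> away from \<open>0\<close>, where division would have the default value \<open>0\<close>.\<close>
  have H_ge_1: "1 \<le> H n v" if "v \<in> V" for n v
    using path_count_pos[of V F v n, OF rows that] by (simp add: H_def)
  have "vertices B n = V" for n
    using assms(4) unfolding stationary_def V_def by blast
  then have m_eq: "m n = (INF v\<in>V. H n v)" for n
    by (simp add: m_def inf_path_count_def H_def)
  have "V \<noteq> {}"
    using assms(1) unfolding V_def generalized_bratteli_def by (metis finite.emptyI)
  then have m_ge_1: "1 \<le> m n" for n
    unfolding m_eq using H_ge_1 by (intro cINF_greatest)
  have m_le: "m n \<le> H n v" if "v \<in> V" for n v
    unfolding m_eq using that by (intro cINF_lower bdd_belowI2[of _ 0]) (auto simp: H_def)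

  have q_H: "((\<lambda>v. q n v * H n v) has_sum 1) V" for n
  proof (induction n)
    case 0
    show ?case
      using q_0 by (rule has_sum_cong[THEN iffD1, rotated]) (simp add: H_def path_count_0)
  next
    case (Suc n)
    have "((\<lambda>v. of_real (q (Suc n) v) * H (Suc n) v) has_sum 1) V"
    proof (rule has_sum_transpose_pairing[where K = F and p = "q n" and h = "H n"])
      show "((\<lambda>w. of_nat (F v w) * H n w) has_sum H (Suc n) v) V" if "v \<in> V" for v
        using has_sum_of_real[where 'a = real, OF has_sum_of_nat[OF path_count_Suc[of V F, OF rows(1) that]]]
        by (simp add: H_def)
      show "(\<lambda>w. q n w * norm (H n w)) summable_on V"
        using Suc.IH by (auto simp: H_def summable_on_def)
    qed (use Suc.IH q_nonneg q_Suc in auto)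
    then show ?case by simp
  qed

  have q_summable: "q n summable_on V" for n
  proof (rule summable_on_comparison_test[OF has_sum_imp_summable[OF q_H]])
    show "q n v \<le> q n v * H n v" if "v \<in> V" for v
      using mult_left_mono[OF H_ge_1[OF that] q_nonneg] by simp
  qed (rule q_nonneg)
  have q_le: "(\<Sum>\<^sub>\<infinity>v\<in>V. q n v) \<le> 1 / m n" for n
  proof -
    have "(\<Sum>\<^sub>\<infinity>v\<in>V. q n v) * m n \<le> 1"
      by (rule has_sum_mono[OF has_sum_cmult_left[OF has_sum_infsum[OF q_summable]] q_H[of n]])
        (intro mult_left_mono m_le q_nonneg)
    then show ?thesis
      using m_ge_1[of n] by (simp add: field_simps)
  qed

  have \<xi>_le_1: "cmod (\<xi> k v) \<le> 1" if "v \<in> V" for k v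
    using assms(8) that by (intro ell2_unit_vector_le_1[of _ V]) (auto simp: orthonormal_basis_def V_def)
  have eigen: "((\<lambda>w. of_nat (F v w) * \<xi> k w) has_sum ev k * \<xi> k v) V" if "v \<in> V" for k v
  proof -
    have "\<xi> k \<in> D" and A_\<xi>: "A (\<xi> k) v = ev k * \<xi> k v"
      using assms(9) by simp_all
    then have "((\<lambda>w. of_nat (F w v) * \<xi> k w) has_sum ev k * \<xi> k v) V"
      using assms(7) that unfolding acts_by_matrix_def V_def A_\<xi>[symmetric] by blast
    then show ?thesis
      by (rule has_sum_cong[THEN iffD1, rotated]) (use assms(5) that in \<open>simp add: V_def\<close>)
  qed

  have pairing_summable: "(\<lambda>v. q n v * cmod (\<xi> k v)) summable_on V" for n k
    by (rule summable_on_comparison_test[OF q_summable[of n]])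
      (auto simp: q_nonneg mult_left_le \<xi>_le_1)
  have orth: "((\<lambda>v. of_real (q 0 v) * \<xi> k v) has_sum 0) V" for k
  proof -
    have "(\<lambda>v. of_real (q 0 v) * \<xi> k v) summable_on V"
      by (rule abs_summable_summable) (use pairing_summable in \<open>simp add: norm_mult q_nonneg\<close>)
    then obtain s where s: "((\<lambda>v. of_real (q 0 v) * \<xi> k v) has_sum s) V"
      by (auto simp: summable_on_def)
    \<comment> \<open>The factor \<open>ev k ^ n\<close> stays inside the sum so that its value \<open>s\<close> is the same for all \<open>n\<close>;
      each step is the transposition of \<open>F\<close> with \<open>F (ev k ^ n * \<xi> k) = ev k ^ Suc n * \<xi> k\<close>.\<close>
    have s_n: "((\<lambda>v. of_real (q n v) * (ev k ^ n * \<xi> k v)) has_sum s) V" for n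
    proof (induction n)
      case 0
      then show ?case using s by simp
    next
      case (Suc n)
      show ?case
      proof (rule has_sum_transpose_pairing[where K = F and p = "q n"])
        show "((\<lambda>w. of_nat (F v w) * (ev k ^ n * \<xi> k w)) has_sum ev k ^ Suc n * \<xi> k v) V"
          if "v \<in> V" for v
          using has_sum_cmult_right[OF eigen[OF that, of k], of "ev k ^ n"] by (simp add: mult_ac)
        show "(\<lambda>w. q n w * norm (ev k ^ n * \<xi> k w)) summable_on V"
          using summable_on_cmult_right[OF pairing_summable[of n k], of "cmod (ev k ^ n)"]
          by (simp add: norm_mult mult_ac)
      qed (use Suc.IH q_nonneg q_Suc in auto)
    qed
    have "cmod s \<le> cmod (ev k ^ n / of_real (m n))" for n
    proof -
      have "cmod s \<le> (\<Sum>\<^sub>\<infinity>v\<in>V. cmod (ev k ^ n) * (q n v * cmod (\<xi> k v)))"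
        by (rule norm_has_sum_bound[OF _ s_n])
          (use has_sum_infsum[OF summable_on_cmult_right[OF pairing_summable[of n k], of "cmod (ev k ^ n)"]]
           in \<open>simp add: norm_mult q_nonneg mult_ac\<close>)
      also have "\<dots> = cmod (ev k ^ n) * (\<Sum>\<^sub>\<infinity>v\<in>V. q n v * cmod (\<xi> k v))"
        by (rule infsum_cmult_right')
      also have "(\<Sum>\<^sub>\<infinity>v\<in>V. q n v * cmod (\<xi> k v)) \<le> (\<Sum>\<^sub>\<infinity>v\<in>V. q n v)"
        by (rule infsum_mono[OF pairing_summable q_summable])
          (auto simp: q_nonneg mult_left_le \<xi>_le_1)
      also have "\<dots> \<le> 1 / m n" by (rule q_le)
      finally show ?thesis
        using m_ge_1[of n] by (simp add: norm_divide mult_left_mono)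
    qed
    moreover have "(\<lambda>n. cmod (ev k ^ n / of_real (m n))) \<longlonglongrightarrow> 0"
      using assms(10) by (intro tendsto_norm_zero) (simp add: m_def)
    ultimately have "cmod s \<le> 0"
      by (intro LIMSEQ_le_const) auto
    with s show ?thesis by simp
  qed

  \<comment> \<open>Being bounded by \<open>1\<close>, the summable function \<open>q 0\<close> is square-summable.\<close>
  have "(q 0 v)\<^sup>2 \<le> q 0 v" if "v \<in> V" for v
  proof -
    have "q 0 v \<le> 1"
      using finite_sum_le_has_sum[OF q_0, of "{v}"] that q_nonneg by simp
    then show ?thesis
      by (simp add: power2_eq_square mult_left_le q_nonneg)
  qed
  then have "(\<lambda>v. (q 0 v)\<^sup>2) summable_on V"
    by (intro summable_on_comparison_test[OF q_summable[of 0]]) auto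
  then have "q 0 v = 0" if "v \<in> V" for v
    using assms(8) orth that by (intro orthogonal_to_basis_imp_0[of V \<xi>]) (simp_all add: V_def)
  then have "(q 0 has_sum 0) V"
    by (simp cong: has_sum_cong)
  with q_0 show False
    using has_sum_unique by fastforce
qed

end
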